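(* Let $p\in(0,1)$ and $\alpha\in(0,1)$. Let $\gamma_1,\gamma_2$ be the probability measures on $\{\pm e_1,\pm e_2\}$ with $\gamma_1(e_1)=\alpha=1-\gamma_1(e_2)$ and $\gamma_2(-e_1)=1$, and let $(\omega_x)_{x\in\mathbb{Z}^2}$ be i.i.d. with $\omega_x=\gamma_1$ with probability $p$ and $\omega_x=\gamma_2$ with probability $1-p$. Then the random walk $(X_n)$ in the random environment $\omega$, started at the origin, satisfies $P(n^{-1}X_n\to v)=1$ with $v=(v^{[1]},v^{[2]})$ given by $$v^{[1]}=(1+\alpha)\left(\alpha+(1-\alpha)\Big(p+\frac1p-1\Big)+\frac{1-p}{1-p\alpha}\right)^{-1}-1,$$ $$v^{[2]}=\left(\frac{\alpha}{1-\alpha}+p+\frac{1-p}{p}+\frac{1-p}{(1-\alpha)(1-p\alpha)}\right)^{-1}.$$ The component $v^{[2]}$ is monotone in each of the two parameters (increasing in $p$ and decreasing in $\alpha$), whereas there exist values of $p\in(0,1)$ for which $\alpha\mapsto v^{[1]}$ is not monotone on $(0,1)$.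
   Context: $e_1=(1,0)$ and $e_2=(0,1)$ are the unit vectors of $\mathbb{Z}^2$. Given the environment $\omega=(\omega_x)_{x\in\mathbb{Z}^2}$, where each $\omega_x$ is a probability measure on $\{\pm e_1,\pm e_2\}$, the walk is the time-homogeneous Markov chain $(X_n)_{n\ge0}$ on $\mathbb{Z}^2$ with $X_0=0$ and transition probability $\omega_x(e)$ from $x$ to $x+e$. The environment is sampled once and kept fixed. $P$ denotes the annealed law, i.e. the law of the walk averaged over the environment. *)

theory Defs
  imports "HOL-Probability.Probability"
begin

type_synonym site = "int \<times> int"
type_synonym env = "site \<Rightarrow> site pmf"

abbreviation e1 :: site where "e1 \<equiv> (1, 0)"
abbreviation e2 :: site where "e2 \<equiv> (0, 1)"

text \<open>The quenched walk is built by the Ionescu-Tulcea construction: the \<open>n\<close>-th coordinate, given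
  the history \<open>h\<close> at the times below \<open>n\<close>, has distribution \<open>walk_kernel \<omega> n h\<close>.\<close>

definition walk_kernel :: "env \<Rightarrow> nat \<Rightarrow> (nat \<Rightarrow> site) \<Rightarrow> site measure" where
  "walk_kernel \<omega> n h = measure_pmf
     (if n = 0 then return_pmf 0 else map_pmf (\<lambda>e. h (n - 1) + e) (\<omega> (h (n - 1))))"

abbreviation path_space :: "(nat \<Rightarrow> site) measure" where
  "path_space \<equiv> PiM UNIV (\<lambda>_. count_space UNIV)"

abbreviation env_space :: "env measure" where
  "env_space \<equiv> PiM UNIV (\<lambda>_. count_space UNIV)"

interpretation walk: Ionescu_Tulcea "walk_kernel \<omega>" "\<lambda>_. count_space UNIV" for \<omega>
proof (rule Ionescu_Tulcea.intro)
  show "walk_kernel \<omega> i \<in> measurable (PiM {0..<i} (\<lambda>_. count_space UNIV)) (subprob_algebra (count_space UNIV))" for i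
  proof (cases i)
    case 0
    then show ?thesis
      by (simp add: walk_kernel_def[abs_def] measure_pmf_in_subprob_algebra)
  next
    case (Suc k)
    let ?K = "\<lambda>x. measure_pmf (map_pmf (\<lambda>e. x + e) (\<omega> x))"
    have "(\<lambda>h. ?K (h k)) \<in> measurable (PiM {0..<i} (\<lambda>_. count_space UNIV)) (subprob_algebra (count_space UNIV))"
      by (rule measurable_compose[OF measurable_component_singleton])
         (auto simp: Suc measure_pmf_in_subprob_algebra)
    with Suc show ?thesis
      by (simp add: walk_kernel_def[abs_def])
  qed
qed (simp add: walk_kernel_def measure_pmf.prob_space_axioms)

definition quenched_law :: "env \<Rightarrow> (nat \<Rightarrow> site) measure" where
  "quenched_law \<omega> = walk.PF.lim \<omega>"

definition annealed_law :: "env measure \<Rightarrow> (nat \<Rightarrow> site) measure" where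
  "annealed_law E = E \<bind> quenched_law"

definition iid_env_law :: "site pmf pmf \<Rightarrow> env measure" where
  "iid_env_law \<mu> = PiM UNIV (\<lambda>_. measure_pmf \<mu>)"

definition gamma1 :: "real \<Rightarrow> site pmf" where
  "gamma1 \<alpha> = map_pmf (\<lambda>b. if b then e1 else e2) (bernoulli_pmf \<alpha>)"

definition gamma2 :: "site pmf" where
  "gamma2 = return_pmf (- e1)"

definition site_law :: "real \<Rightarrow> real \<Rightarrow> site pmf pmf" where
  "site_law p \<alpha> = map_pmf (\<lambda>b. if b then gamma1 \<alpha> else gamma2) (bernoulli_pmf p)"

definition v1 :: "real \<Rightarrow> real \<Rightarrow> real" where
  "v1 p \<alpha> = (1 + \<alpha>) * inverse (\<alpha> + (1 - \<alpha>) * (p + 1 / p - 1) + (1 - p) / (1 - p * \<alpha>)) - 1"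

definition v2 :: "real \<Rightarrow> real \<Rightarrow> real" where
  "v2 p \<alpha> = inverse (\<alpha> / (1 - \<alpha>) + p + (1 - p) / p + (1 - p) / ((1 - \<alpha>) * (1 - p * \<alpha>)))"


text \<open>The laws above are well defined: \<open>quenched_law \<omega>\<close> is the law of the Markov chain in the
  environment \<open>\<omega>\<close>, it depends measurably on \<open>\<omega>\<close>, and the mixture is a probability measure.\<close>

lemma sets_quenched_law: "sets (quenched_law \<omega>) = sets path_space"
  by (simp add: quenched_law_def)

lemma space_quenched_law: "space (quenched_law \<omega>) = UNIV"
  by (simp add: quenched_law_def space_PiM)

lemma emeasure_C_path:
  "emeasure (walk.C \<omega> 0 n (\<lambda>_. undefined)) {restrict x {0..<n}}
     = (\<Prod>i<n. emeasure (walk_kernel \<omega> i x) {x i})"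
proof (induction n)
  case 0
  have "(\<lambda>i\<in>{0..<0}. x i) = (\<lambda>_. undefined)" by auto
  then show ?case by (simp add: PiM_empty)
next
  case (Suc n)
  let ?M = "\<lambda>n. PiM {0..<n} (\<lambda>_. count_space (UNIV :: site set))"
  let ?C = "walk.C \<omega> 0 n (\<lambda>_. undefined)"
  have u: "(\<lambda>_. undefined) \<in> space (PiM {0..<0} (\<lambda>_. count_space (UNIV :: site set)))"
    by (simp add: space_PiM PiE_def extensional_def)
  have sing: "{restrict x {0..<m}} \<in> sets (?M m)" for m
  proof -
    have "{restrict x {0..<m}} = (\<Pi>\<^sub>E i\<in>{0..<m}. {x i})"
      by (auto simp: PiE_iff extensional_def fun_eq_iff)
    then show ?thesis by (simp add: sets_PiM_I_finite)
  qed
  have [measurable_cong]: "sets ?C = sets (?M n)"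
    using walk.sets_C[OF u, of \<omega> n] by simp
  have ne: "space ?C \<noteq> {}"
    using walk.space_C[OF u, of \<omega> n] by (simp add: space_PiM PiE_eq_empty_iff)
  have eP: "walk.eP \<omega> n \<in> measurable ?C (subprob_algebra (?M (Suc n)))"
    by measurable
  have "emeasure (walk.C \<omega> 0 (Suc n) (\<lambda>_. undefined)) {restrict x {0..<Suc n}}
      = (\<integral>\<^sup>+h. emeasure (walk.eP \<omega> n h) {restrict x {0..<Suc n}} \<partial>?C)"
    by (simp add: emeasure_bind[OF ne eP sing])
  also have "\<dots> = (\<integral>\<^sup>+h. emeasure (walk_kernel \<omega> n x) {x n} * indicator {restrict x {0..<n}} h \<partial>?C)"
  proof (rule nn_integral_cong)
    fix h assume "h \<in> space ?C"
    then have h: "h \<in> space (?M n)"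
      using walk.space_C[OF u, of \<omega> n] by simp
    then have ext: "h \<in> extensional {0..<n}" by (simp add: space_PiM PiE_def)
    have eq: "fun_upd h n y = restrict x {0..<Suc n} \<longleftrightarrow> h = restrict x {0..<n} \<and> y = x n" for y
    proof
      assume *: "fun_upd h n y = restrict x {0..<Suc n}"
      have "h i = restrict x {0..<n} i" for i
        using fun_cong[OF *, of i] ext by (cases "i = n") (auto simp: extensional_def)
      with fun_cong[OF *, of n] show "h = restrict x {0..<n} \<and> y = x n" by auto
    qed auto
    have "emeasure (walk.eP \<omega> n h) {restrict x {0..<Suc n}}
       = emeasure (walk_kernel \<omega> n h) {y. h = restrict x {0..<n} \<and> y = x n}"
      using walk.emeasure_eP[OF h sing, of \<omega>] by (simp add: eq vimage_def)
    also have "\<dots> = emeasure (walk_kernel \<omega> n x) {x n} * indicator {restrict x {0..<n}} h"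
    proof (cases "h = restrict x {0..<n}")
      case True
      have "walk_kernel \<omega> n h = walk_kernel \<omega> n x"
        using True by (simp add: walk_kernel_def)
      with True show ?thesis by simp
    qed simp
    finally show "emeasure (walk.eP \<omega> n h) {restrict x {0..<Suc n}}
       = emeasure (walk_kernel \<omega> n x) {x n} * indicator {restrict x {0..<n}} h" .
  qed
  also have "\<dots> = emeasure (walk_kernel \<omega> n x) {x n} * emeasure ?C {restrict x {0..<n}}"
    using sing[of n] by (subst nn_integral_cmult_indicator) (simp_all add: \<open>sets ?C = sets (?M n)\<close>)
  finally show ?case
    by (simp only: Suc prod.lessThan_Suc mult.commute)
qed

lemma emeasure_quenched_law:
  "emeasure (quenched_law \<omega>) {X. \<forall>i<n. X i = x i} = (\<Prod>i<n. emeasure (walk_kernel \<omega> i x) {x i})"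
proof -
  let ?M = "PiM {0..<n} (\<lambda>_. count_space (UNIV :: site set))"
  have sq: "{restrict x {0..<n}} = (\<Pi>\<^sub>E i\<in>{0..<n}. {x i})"
    by (auto simp: PiE_iff extensional_def fun_eq_iff)
  then have sing: "{restrict x {0..<n}} \<in> sets ?M" by (simp add: sets_PiM_I_finite)
  have "{X. \<forall>i<n. X i = x i} = prod_emb UNIV (\<lambda>_. count_space UNIV) {0..<n} {restrict x {0..<n}}"
    by (auto simp: prod_emb_def space_PiM fun_eq_iff restrict_apply split: if_splits)
  then have "emeasure (quenched_law \<omega>) {X. \<forall>i<n. X i = x i} = emeasure (walk.CI \<omega> {0..<n}) {restrict x {0..<n}}"
    using walk.lim[of "{0..<n}", OF _ sing] by (simp add: quenched_law_def)
  also have "\<dots> = emeasure (walk.C \<omega> 0 n (\<lambda>_. undefined)) (prod_emb {0..<n} (\<lambda>_. count_space UNIV) {0..<n} {restrict x {0..<n}})"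
    using walk.emeasure_CI[of "{0..<n}" n, OF _ sing] by simp
  also have "prod_emb {0..<n} (\<lambda>_. count_space UNIV) {0..<n} {restrict x {0..<n}} = {restrict x {0..<n}}"
    using sing by (intro prod_emb_id) (auto simp: space_PiM)
  finally show ?thesis by (simp add: emeasure_C_path)
qed

lemma emeasure_quenched_path:
  "emeasure (quenched_law \<omega>) {X. \<forall>i\<le>n. X i = x i}
     = (if x 0 = 0 then \<Prod>i<n. ennreal (pmf (\<omega> (x i)) (x (Suc i) - x i)) else 0)"
proof -
  have *: "emeasure (walk_kernel \<omega> (Suc i) x) {x (Suc i)} = ennreal (pmf (\<omega> (x i)) (x (Suc i) - x i))" for i
  proof -
    have "(\<lambda>e. x i + e) -` {x (Suc i)} = {x (Suc i) - x i}" by (auto simp: algebra_simps)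
    then show ?thesis
      by (simp add: walk_kernel_def emeasure_pmf_single pmf_map measure_pmf_single)
  qed
  have "emeasure (quenched_law \<omega>) {X. \<forall>i\<le>n. X i = x i}
      = (\<Prod>i<Suc n. emeasure (walk_kernel \<omega> i x) {x i})"
    using emeasure_quenched_law[of \<omega> "Suc n" x] by (simp add: less_Suc_eq_le del: prod.lessThan_Suc)
  also have "\<dots> = emeasure (walk_kernel \<omega> 0 x) {x 0} * (\<Prod>i<n. ennreal (pmf (\<omega> (x i)) (x (Suc i) - x i)))"
    by (simp add: prod.lessThan_Suc_shift * del: prod.lessThan_Suc)
  also have "emeasure (walk_kernel \<omega> 0 x) {x 0} = (if x 0 = 0 then 1 else 0)"
    by (auto simp: walk_kernel_def emeasure_pmf_single)
  finally show ?thesis by simp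
qed

lemma prob_space_quenched_law: "prob_space (quenched_law \<omega>)"
  using emeasure_quenched_law[of \<omega> 0] by (intro prob_spaceI) (simp add: space_quenched_law)

lemma measurable_quenched_law: "quenched_law \<in> measurable env_space (prob_algebra path_space)"
proof (rule measurable_prob_algebra_generated)
  let ?cyl = "\<lambda>n x. {X :: nat \<Rightarrow> site. \<forall>i<n. X i = x i}"
  let ?G = "insert {} (range (\<lambda>(n, x). ?cyl n x))"
  show "Int_stable ?G"
  proof (rule Int_stableI)
    fix A B assume AB: "A \<in> ?G" "B \<in> ?G"
    show "A \<inter> B \<in> ?G"
    proof (cases "A \<inter> B = {}")
      case False
      then obtain z where z: "z \<in> A" "z \<in> B" by auto
      with AB obtain n x m y where "A = ?cyl n x" "B = ?cyl m y" by auto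
      with z have "A = ?cyl n z" "B = ?cyl m z" by auto
      then have "A \<inter> B = ?cyl (max n m) z" by (auto simp: less_max_iff_disj)
      then show ?thesis by auto
    qed simp
  qed
  show "?G \<subseteq> Pow UNIV" by simp
  show "sets path_space = sigma_sets UNIV ?G"
  proof (rule antisym)
    have cyl: "?cyl n x \<in> sets path_space" for n x
    proof -
      have "?cyl n x = {X \<in> space path_space. \<forall>i<n. X i = x i}" by (simp add: space_PiM)
      also have "\<dots> \<in> sets path_space" by measurable
      finally show ?thesis .
    qed
    then have "sigma_sets (space path_space) ?G \<subseteq> sets path_space"
      by (intro sets.sigma_sets_subset) auto
    then show "sigma_sets UNIV ?G \<subseteq> sets path_space" by (simp add: space_PiM)
    interpret S: sigma_algebra UNIV "sigma_sets UNIV ?G"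
      by (rule sigma_algebra_sigma_sets) simp
    have one: "{X. X i \<in> A} \<in> sigma_sets UNIV ?G" for i and A :: "site set"
    proof -
      let ?L = "{l. length l = Suc i \<and> l ! i \<in> A}"
      have "{X. X i \<in> A} = (\<Union>l\<in>?L. ?cyl (Suc i) (\<lambda>j. l ! j))"
      proof (intro set_eqI iffI)
        fix X :: "nat \<Rightarrow> site" assume "X \<in> {X. X i \<in> A}"
        then show "X \<in> (\<Union>l\<in>?L. ?cyl (Suc i) (\<lambda>j. l ! j))"
          by (intro UN_I[of "map X [0..<Suc i]"]) (auto simp: nth_append less_Suc_eq)
      qed auto
      also have "\<dots> \<in> sigma_sets UNIV ?G"
        by (rule S.countable_UN'') (auto intro!: sigma_sets.Basic)
      finally show ?thesis .
    qed
    show "sets path_space \<subseteq> sigma_sets UNIV ?G"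
    proof -
      have "sets path_space = sigma_sets UNIV {{X. X i \<in> A} |i A. True}"
        unfolding sets_PiM_single by simp
      also have "\<dots> \<subseteq> sigma_sets UNIV ?G"
        using one by (intro S.sigma_sets_subset) blast
      finally show ?thesis .
    qed
  qed
  show "(\<lambda>\<omega>. emeasure (quenched_law \<omega>) A) \<in> borel_measurable env_space" if "A \<in> ?G" for A
  proof (cases "A = {}")
    case False
    with that obtain n x where A: "A = ?cyl n x" by auto
    have "(\<lambda>\<omega>. emeasure (walk_kernel \<omega> i x) {x i}) \<in> borel_measurable env_space" for i
    proof -
      have "(\<lambda>\<omega>. emeasure (measure_pmf (map_pmf (\<lambda>e. x (i - 1) + e) (\<omega> (x (i - 1))))) {x i})
          \<in> borel_measurable env_space"
        by (rule measurable_compose[OF measurable_component_singleton]) auto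
      then show ?thesis by (cases "i = 0") (simp_all add: walk_kernel_def)
    qed
    then show ?thesis by (simp add: A emeasure_quenched_law)
  qed simp
qed (simp_all add: prob_space_quenched_law sets_quenched_law)

lemma iid_env_law_in_prob_algebra: "iid_env_law \<mu> \<in> space (prob_algebra env_space)"
proof -
  have "sets (iid_env_law \<mu>) = sets env_space"
    unfolding iid_env_law_def by (intro sets_PiM_cong) auto
  moreover have "prob_space (iid_env_law \<mu>)"
    unfolding iid_env_law_def by (intro prob_space_PiM measure_pmf.prob_space_axioms)
  ultimately show ?thesis by (simp add: space_prob_algebra)
qed

lemma prob_space_annealed_law: "prob_space (annealed_law (iid_env_law \<mu>))"
  unfolding annealed_law_def
  by (rule prob_space_bind'[OF iid_env_law_in_prob_algebra measurable_quenched_law])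

lemma sets_annealed_law: "sets (annealed_law (iid_env_law \<mu>)) = sets path_space"
  unfolding annealed_law_def
  by (rule sets_bind'[OF iid_env_law_in_prob_algebra measurable_quenched_law])

end

(*
  A row, once left, is never revisited, so under the annealed law the walk only needs to remember
  what it knows about the sites around it. Call a site a block if it carries gamma2. The walk has
  just arrived in a row, is heading east or west into unexplored sites, stands at a gamma1 site
  immediately west of a block, or stands on a block immediately east of a gamma1 site. These five
  phases form a Markov chain that drives the annealed walk. If f solves the Poisson equation of this
  chain for an additive functional g of the position with drift v, then g(X_n) - n v + f(phase) is a
  martingale with bounded increments, and Hoeffding's lemma, Markov's inequality for exponential
  moments and the Borel-Cantelli lemma give g(X_n) / n -> v almost surely. The solutions come from
  the expected duration and displacement until the walk next moves up: v2 is the inverse of the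
  expected duration of a row, and v1 is the ratio of its expected displacement and duration.
*)

theory Submission
  imports Defs
begin

section \<open>Cylinder probabilities of the quenched law\<close>

text \<open>The newest position comes first, so that one more step of the walk is one cons and all
  later recursions over lists follow time.\<close>

fun history :: "(nat \<Rightarrow> site) \<Rightarrow> nat \<Rightarrow> site list" where
  "history X 0 = [X 0]"
| "history X (Suc n) = X (Suc n) # history X n"

lemma length_history [simp]: "length (history X n) = Suc n"
  by (induction n) auto

lemma hd_history [simp]: "hd (history X n) = X n"
  by (cases n) auto

lemma history_ne_Nil [simp]: "history X n \<noteq> []"
  by (cases n) auto

lemma history_eq_iff: "history X n = history x n \<longleftrightarrow> (\<forall>i\<le>n. X i = x i)"
  by (induction n) (auto simp: le_Suc_eq)

lemma history_surj: "length h = Suc n \<Longrightarrow> \<exists>x. history x n = h"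
proof (induction n arbitrary: h)
  case 0
  then obtain z where "h = [z]" by (cases h) auto
  then show ?case by (intro exI[of _ "\<lambda>_. z"]) simp
next
  case (Suc n)
  then obtain z h' where h: "h = z # h'" "length h' = Suc n" by (cases h) auto
  with Suc.IH obtain x where x: "history x n = h'" by blast
  have "history (x(Suc n := z)) n = history x n"
    by (subst history_eq_iff) auto
  with x h show ?case by (intro exI[of _ "x(Suc n := z)"]) (simp only: history.simps fun_upd_same)
qed

lemma measurable_history [measurable]: "(\<lambda>X. history X n) \<in> measurable path_space (count_space UNIV)"
proof (subst measurable_count_space_eq2_countable)
  have "(\<lambda>X. history X n) -` {h} \<inter> space path_space \<in> sets path_space" for h
  proof (cases "length h = Suc n")
    case True
    then obtain x where x: "history x n = h" using history_surj by blast
    have "(\<lambda>X. history X n) -` {h} \<inter> space path_space = {X \<in> space path_space. \<forall>i\<le>n. X i = x i}"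
      by (auto simp flip: x simp: history_eq_iff space_PiM)
    also have "\<dots> \<in> sets path_space" by measurable
    finally show ?thesis .
  next
    case False
    then have "(\<lambda>X. history X n) -` {h} = {}" by auto
    then show ?thesis by simp
  qed
  then show "(\<lambda>X. history X n) \<in> space path_space \<rightarrow> UNIV \<and>
    (\<forall>h\<in>UNIV. (\<lambda>X. history X n) -` {h} \<inter> space path_space \<in> sets path_space)" by auto
qed

text \<open>Meant as the probability of a history in a fixed environment. The value 0 at
  \<open>[]\<close> is a default, since a history contains at least the starting point.\<close>

fun quenched_weight :: "env \<Rightarrow> site list \<Rightarrow> real" where
  "quenched_weight \<omega> [] = 0"
| "quenched_weight \<omega> [z] = of_bool (z = 0)"
| "quenched_weight \<omega> (z # z' # h) = pmf (\<omega> z') (z - z') * quenched_weight \<omega> (z' # h)"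

lemma quenched_weight_nonneg: "quenched_weight \<omega> h \<ge> 0"
  by (induction \<omega> h rule: quenched_weight.induct) auto

lemma quenched_weight_history:
  "ennreal (quenched_weight \<omega> (history x n))
     = (if x 0 = 0 then \<Prod>i<n. ennreal (pmf (\<omega> (x i)) (x (Suc i) - x i)) else 0)"
proof (induction n)
  case (Suc n)
  obtain h where h: "history x n = x n # h"
    by (metis hd_history history_ne_Nil list.collapse)
  from Suc show ?case
    by (simp add: h ennreal_mult quenched_weight_nonneg mult.commute)
qed auto

lemma emeasure_quenched_history:
  assumes "length h = Suc n"
  shows "emeasure (quenched_law \<omega>) {X. history X n = h} = quenched_weight \<omega> h"
proof -
  obtain x where x: "history x n = h" using history_surj assms by blast
  have "{X. history X n = h} = {X. \<forall>i\<le>n. X i = x i}"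
    by (simp flip: x add: history_eq_iff)
  then show ?thesis
    by (simp add: emeasure_quenched_path flip: x quenched_weight_history)
qed

section \<open>The annealed walk as a Markov chain on phases\<close>

definition kind_law :: "real \<Rightarrow> bool \<Rightarrow> site pmf" where
  "kind_law \<alpha> b = (if b then gamma1 \<alpha> else gamma2)"

text \<open>Each step reveals the law of the site it leaves: \<open>Some True\<close> stands for \<^const>\<open>gamma1\<close>,
  \<open>Some False\<close> for \<^const>\<open>gamma2\<close>, and \<^const>\<open>None\<close> for a site that has not been left yet.\<close>

fun known :: "site list \<Rightarrow> site \<Rightarrow> bool option" where
  "known (z # z' # h) = (known (z' # h))(z' \<mapsto> z - z' \<noteq> - e1)"
| "known h = Map.empty"

lemma finite_dom_known [simp]: "finite (dom (known h))"
  by (induction h rule: known.induct) (auto simp del: fun_upd_apply)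

text \<open>The probability of a history given that the environment agrees with what it reveals; zero if it
  is contradictory.\<close>

fun coin_weight :: "real \<Rightarrow> site list \<Rightarrow> real" where
  "coin_weight \<alpha> [] = 0"
| "coin_weight \<alpha> [z] = of_bool (z = 0)"
| "coin_weight \<alpha> (z # z' # h) =
     (if known (z' # h) z' = Some (z - z' = - e1) then 0
      else pmf (kind_law \<alpha> (z - z' \<noteq> - e1)) (z - z') * coin_weight \<alpha> (z' # h))"

lemma coin_weight_nonneg: "coin_weight \<alpha> h \<ge> 0"
  by (induction \<alpha> h rule: coin_weight.induct) auto

definition env_prob :: "real \<Rightarrow> (site \<Rightarrow> bool option) \<Rightarrow> real" where
  "env_prob p K = (\<Prod>z\<in>dom K. if K z = Some True then p else 1 - p)"

lemma env_prob_update_new: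
  assumes "finite (dom K)" "K z = None"
  shows "env_prob p (K(z \<mapsto> b)) = (if b then p else 1 - p) * env_prob p K"
proof -
  have "(\<Prod>x\<in>dom K. if (K(z \<mapsto> b)) x = Some True then p else 1 - p) = env_prob p K"
    unfolding env_prob_def using assms(2) by (intro prod.cong) auto
  moreover have "z \<notin> dom K" using assms(2) by auto
  ultimately show ?thesis using assms(1) by (auto simp: env_prob_def)
qed

lemma env_prob_update_same: "K z = Some b \<Longrightarrow> env_prob p (K(z \<mapsto> b)) = env_prob p K"
  by (simp add: map_upd_triv)

datatype phase = Arrived | Eastward | Westward | Before_Block | On_Block

text \<open>A step east from \<open>Westward\<close> returns to the block just crossed; a step west
  from \<open>Eastward\<close> leaves a newly found block for the \<open>gamma1\<close> site before
  it. Impossible combinations, such as a step east from \<open>On_Block\<close>, get default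
  values.\<close>

definition next_phase :: "phase \<Rightarrow> site \<Rightarrow> phase" where
  "next_phase s e =
     (if e = e1 then if s = Arrived \<or> s = Eastward then Eastward else On_Block
      else if e = - e1 then if s = Arrived \<or> s = Westward then Westward else Before_Block
      else Arrived)"

fun phase_of :: "site list \<Rightarrow> phase" where
  "phase_of (z # z' # h) = next_phase (phase_of (z' # h)) (z - z')"
| "phase_of h = Arrived"

text \<open>The invariant linking a phase to the revealed environment. That all higher rows are
  untouched is what restores \<open>Arrived\<close> after a step up; within the row it records the
  kinds just met or the unexplored half-row ahead.\<close>

definition explored :: "phase \<Rightarrow> site \<Rightarrow> (site \<Rightarrow> bool option) \<Rightarrow> bool" where
  "explored s z K \<longleftrightarrow> (\<forall>x y. y > snd z \<longrightarrow> K (x, y) = None) \<and>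
     (case s of
        Arrived \<Rightarrow> \<forall>x. K (x, snd z) = None
      | Eastward \<Rightarrow> K (z - e1) = Some True \<and> (\<forall>x\<ge>fst z. K (x, snd z) = None)
      | Westward \<Rightarrow> K (z + e1) = Some False \<and> (\<forall>x\<le>fst z. K (x, snd z) = None)
      | Before_Block \<Rightarrow> K z = Some True \<and> K (z + e1) = Some False
      | On_Block \<Rightarrow> K z = Some False \<and> K (z - e1) = Some True)"

lemma kind_law_support:
  assumes "pmf (kind_law \<alpha> b) s \<noteq> 0"
  shows "s \<in> (if b then {e1, e2} else {- e1})"
  using assms
  by (auto simp: kind_law_def gamma1_def gamma2_def simp flip: set_pmf_iff split: if_splits)

text \<open>While the walk goes straight, the half-row ahead stays unexplored. Its first turn
  happens between a \<open>gamma1\<close> site and the block east of it, and these two sites then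
  confine it until it moves up. Nonzero weight excludes steps that contradict a kind already
  revealed.\<close>

lemma explored_history: "coin_weight \<alpha> h \<noteq> 0 \<Longrightarrow> explored (phase_of h) (hd h) (known h)"
proof (induction \<alpha> h rule: coin_weight.induct)
  case (3 \<alpha> z z' h)
  let ?s = "z - z'" let ?b = "?s \<noteq> - e1" let ?K = "known (z' # h)"
  from 3 have K: "?K z' \<noteq> Some (\<not> ?b)" and s: "pmf (kind_law \<alpha> ?b) ?s \<noteq> 0"
    and IH: "explored (phase_of (z' # h)) z' ?K" by (auto split: if_splits)
  have z: "z = z' + ?s" by simp
  obtain x y where z': "z' = (x, y)" by (cases z')
  from kind_law_support[OF s] consider "?s = e1" | "?s = e2" | "?s = - e1" by (auto split: if_splits)
  then show ?case
  proof cases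
    case 1
    then have "z = (x + 1, y)" using z z' by auto
    then show ?thesis using IH K 1 z'
      by (cases "phase_of (z' # h)") (auto simp: explored_def next_phase_def)
  next
    case 2
    then have "z = (x, y + 1)" using z z' by auto
    then show ?thesis using IH K 2 z'
      by (auto simp: explored_def next_phase_def)
  next
    case 3
    then have "z = (x - 1, y)" using z z' by (metis add_Pair add.right_neutral diff_conv_add_uminus uminus_Pair neg_0_equal_iff_equal minus_zero)
    then show ?thesis using IH K 3 z'
      by (cases "phase_of (z' # h)") (auto simp: explored_def next_phase_def)
  qed
qed (auto simp: explored_def next_phase_def)

section \<open>Averaging the quenched weight over the environment\<close>

lemma kind_law_inj: "kind_law \<alpha> b = kind_law \<alpha> b' \<longleftrightarrow> b = b'"
proof -
  have "- e1 \<in> set_pmf gamma2" "- e1 \<notin> set_pmf (gamma1 \<alpha>)"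
    by (auto simp: gamma1_def gamma2_def)
  then have "gamma1 \<alpha> \<noteq> gamma2" by auto
  then show ?thesis by (auto simp: kind_law_def)
qed

lemma site_law_eq: "site_law p \<alpha> = map_pmf (kind_law \<alpha>) (bernoulli_pmf p)"
  by (simp add: site_law_def kind_law_def[abs_def])

lemma AE_env_kind: "AE \<omega> in iid_env_law (site_law p \<alpha>). \<forall>z. \<exists>b. \<omega> z = kind_law \<alpha> b"
  unfolding iid_env_law_def
  by (intro AE_all_countable[THEN iffD2] allI AE_PiM_component[where M="\<lambda>_. measure_pmf _"])
     (auto simp: AE_measure_pmf_iff site_law_eq measure_pmf.prob_space_axioms)

definition compatible :: "real \<Rightarrow> (site \<Rightarrow> bool option) \<Rightarrow> env set" where
  "compatible \<alpha> K = {\<omega>. \<forall>z\<in>dom K. \<omega> z = kind_law \<alpha> (the (K z))}"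

lemma compatibleD:
  assumes "\<omega> \<in> compatible \<alpha> K" "K z = Some b"
  shows "\<omega> z = kind_law \<alpha> b"
proof -
  have "z \<in> dom K" using assms(2) by (rule domI)
  with assms(1) have "\<omega> z = kind_law \<alpha> (the (K z))" unfolding compatible_def by blast
  with assms(2) show ?thesis by simp
qed

lemma compatible_update:
  assumes "K z \<noteq> Some (\<not> b)"
  shows "\<omega> \<in> compatible \<alpha> (K(z \<mapsto> b)) \<longleftrightarrow> \<omega> z = kind_law \<alpha> b \<and> \<omega> \<in> compatible \<alpha> K"
proof (cases "K z")
  case None
  then have "z \<notin> dom K" by auto
  then show ?thesis unfolding compatible_def by auto
next
  case (Some b')
  with assms have "K z = Some b" by (cases b; cases b') auto
  then show ?thesis using compatibleD[of \<omega> \<alpha> K z b] by (auto simp: map_upd_triv)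
qed

text \<open>Every possible step determines the kind of the site it leaves, because the two laws have
  disjoint supports. Hence the weight splits into a factor free of \<omega> and the indicator of
  what the history reveals, and only the indicator has to be averaged.\<close>

lemma quenched_weight_eq:
  assumes "\<forall>z. \<exists>b. \<omega> z = kind_law \<alpha> b"
  shows "quenched_weight \<omega> h = coin_weight \<alpha> h * indicator (compatible \<alpha> (known h)) \<omega>"
proof (induction h rule: known.induct)
  case (1 z z' h)
  define b where "b \<longleftrightarrow> z - z' \<noteq> - e1"
  let ?K = "known (z' # h)"
  obtain b' where b': "\<omega> z' = kind_law \<alpha> b'" using assms by blast
  have K: "known (z # z' # h) = ?K(z' \<mapsto> b)" by (simp only: known.simps b_def)
  have pmf: "pmf (\<omega> z') (z - z') = pmf (kind_law \<alpha> b) (z - z') * of_bool (b' = b)"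
  proof (cases "b' = b")
    case False
    then have "pmf (kind_law \<alpha> b') (z - z') = 0"
      using kind_law_support[of \<alpha> b' "z - z'"] unfolding b_def by (cases b') auto
    then show ?thesis using b' False by simp
  qed (simp add: b')
  have cw: "coin_weight \<alpha> (z # z' # h) = (if ?K z' = Some (\<not> b) then 0
      else pmf (kind_law \<alpha> b) (z - z') * coin_weight \<alpha> (z' # h))"
    by (simp only: coin_weight.simps b_def not_not)
  have QW: "quenched_weight \<omega> (z # z' # h) = pmf (kind_law \<alpha> b) (z - z') * coin_weight \<alpha> (z' # h)
      * (of_bool (b' = b) * indicator (compatible \<alpha> ?K) \<omega>)"
    by (simp only: quenched_weight.simps pmf 1 mult_ac)
  show ?case
  proof (cases "?K z' = Some (\<not> b)")
    \<comment> \<open>The history contradicts itself at \<open>z'\<close>: no environment satisfies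
      both the earlier and the new revelation, so both sides vanish.\<close>
    case True
    have "\<omega> z' = kind_law \<alpha> (\<not> b)" if "\<omega> \<in> compatible \<alpha> ?K"
      using that True by (rule compatibleD)
    then have "b' = (\<not> b)" if "\<omega> \<in> compatible \<alpha> ?K"
      using that unfolding b' kind_law_inj .
    then have "of_bool (b' = b) * indicator (compatible \<alpha> ?K) \<omega> = (0 :: real)"
      by (auto simp: indicator_def)
    then show ?thesis by (simp only: QW cw True simp_thms if_True mult_zero_right mult_zero_left)
  next
    case False
    from compatible_update[where K = ?K and z = z' and b = b and \<omega> = \<omega> and \<alpha> = \<alpha>, OF this]
    have "\<omega> \<in> compatible \<alpha> (?K(z' \<mapsto> b)) \<longleftrightarrow> b' = b \<and> \<omega> \<in> compatible \<alpha> ?K"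
      unfolding b' kind_law_inj .
    then have "of_bool (b' = b) * indicator (compatible \<alpha> ?K) \<omega>
        = (indicator (compatible \<alpha> (?K(z' \<mapsto> b))) \<omega> :: real)"
      by (simp add: indicator_def)
    then show ?thesis by (simp only: QW K cw False if_False mult_ac)
  qed
qed (auto simp: compatible_def)

lemma emeasure_compatible:
  assumes "finite (dom K)" "p \<in> {0<..<1}"
  shows "compatible \<alpha> K \<in> sets env_space"
    and "emeasure (iid_env_law (site_law p \<alpha>)) (compatible \<alpha> K) = env_prob p K"
proof -
  let ?A = "\<lambda>z. {kind_law \<alpha> (the (K z))}"
  have eq: "compatible \<alpha> K = prod_emb UNIV (\<lambda>_. measure_pmf (site_law p \<alpha>)) (dom K) (Pi\<^sub>E (dom K) ?A)"
    unfolding compatible_def prod_emb_def space_PiM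
    by (simp add: PiE_UNIV_domain, simp only: set_eq_iff vimage_eq restrict_PiE_iff mem_Collect_eq singleton_iff, intro allI refl)
  \<comment> \<open>By injectivity of \<open>kind_law\<close> exactly one outcome of the coin yields
    a given law.\<close>
  have single: "emeasure (measure_pmf (site_law p \<alpha>)) {kind_law \<alpha> b} = ennreal (if b then p else 1 - p)" for b
  proof -
    have "kind_law \<alpha> -` {kind_law \<alpha> b} = {b}" by (auto simp: kind_law_inj)
    then have "emeasure (measure_pmf (site_law p \<alpha>)) {kind_law \<alpha> b} = ennreal (pmf (bernoulli_pmf p) b)"
      unfolding site_law_eq emeasure_map_pmf by (simp only: emeasure_pmf_single)
    with assms(2) show ?thesis by (cases b) simp_all
  qed
  have "emeasure (iid_env_law (site_law p \<alpha>)) (compatible \<alpha> K) =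
      (\<Prod>z\<in>dom K. emeasure (measure_pmf (site_law p \<alpha>)) (?A z))"
    unfolding iid_env_law_def eq using assms(1)
    by (intro emeasure_PiM_emb) (auto simp: measure_pmf.prob_space_axioms)
  also have "\<dots> = (\<Prod>z\<in>dom K. ennreal (if K z = Some True then p else 1 - p))"
  proof (intro prod.cong refl)
    fix z assume "z \<in> dom K"
    then obtain b where "K z = Some b" by (rule domD[THEN exE])
    then show "emeasure (measure_pmf (site_law p \<alpha>)) (?A z) = ennreal (if K z = Some True then p else 1 - p)"
      by (simp add: single)
  qed
  finally show "emeasure (iid_env_law (site_law p \<alpha>)) (compatible \<alpha> K) = env_prob p K"
    using assms(2) by (simp add: env_prob_def prod_ennreal)
  have "compatible \<alpha> K = {\<omega> \<in> space env_space. \<forall>z\<in>dom K. \<omega> z = kind_law \<alpha> (the (K z))}"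
    unfolding compatible_def by (simp add: space_PiM)
  also have "\<dots> \<in> sets env_space"
    using countable_finite[OF assms(1)] by measurable
  finally show "compatible \<alpha> K \<in> sets env_space" .
qed

lemma emeasure_annealed_history:
  assumes "p \<in> {0<..<1}" "length h = Suc n"
  shows "emeasure (annealed_law (iid_env_law (site_law p \<alpha>))) {X. history X n = h}
    = coin_weight \<alpha> h * env_prob p (known h)"
proof -
  let ?E = "iid_env_law (site_law p \<alpha>)" let ?C = "compatible \<alpha> (known h)"
  have [simp]: "sets ?E = sets env_space"
    using iid_env_law_in_prob_algebra by (simp add: space_prob_algebra)
  have "{X. history X n = h} = (\<lambda>X. history X n) -` {h} \<inter> space path_space"
    by (auto simp: space_PiM)
  also have "\<dots> \<in> sets path_space" by (rule measurable_sets[OF measurable_history]) simp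
  finally have "emeasure (annealed_law ?E) {X. history X n = h} =
      (\<integral>\<^sup>+\<omega>. emeasure (quenched_law \<omega>) {X. history X n = h} \<partial>?E)"
    unfolding annealed_law_def
    by (rule emeasure_bind_prob_algebra[OF iid_env_law_in_prob_algebra measurable_quenched_law])
  also have "\<dots> = (\<integral>\<^sup>+\<omega>. ennreal (coin_weight \<alpha> h) * indicator ?C \<omega> \<partial>?E)"
    using AE_env_kind
    by (intro nn_integral_cong_AE, eventually_elim)
       (auto simp: emeasure_quenched_history[OF assms(2)] quenched_weight_eq split: split_indicator)
  also have "\<dots> = ennreal (coin_weight \<alpha> h) * emeasure ?E ?C"
    using assms(1) by (intro nn_integral_cmult_indicator) (simp add: emeasure_compatible)
  also have "\<dots> = coin_weight \<alpha> h * env_prob p (known h)"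
    using assms(1) by (simp add: emeasure_compatible ennreal_mult' coin_weight_nonneg)
  finally show ?thesis .
qed

section \<open>The phase chain and its identification with the annealed walk\<close>

definition phase_law :: "real \<Rightarrow> real \<Rightarrow> phase \<Rightarrow> site pmf" where
  "phase_law p \<alpha> s =
     (case s of Before_Block \<Rightarrow> kind_law \<alpha> True | On_Block \<Rightarrow> kind_law \<alpha> False
      | _ \<Rightarrow> bind_pmf (bernoulli_pmf p) (kind_law \<alpha>))"

text \<open>The whole history is kept, although its head and phase alone decide the next step, so
  that its law can be compared point by point with that of \<open>history X n\<close>.\<close>

primrec phase_walk :: "real \<Rightarrow> real \<Rightarrow> nat \<Rightarrow> site list pmf" where
  "phase_walk p \<alpha> 0 = return_pmf [0]"
| "phase_walk p \<alpha> (Suc n) = bind_pmf (phase_walk p \<alpha> n)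
     (\<lambda>h. map_pmf (\<lambda>s. (hd h + s) # h) (phase_law p \<alpha> (phase_of h)))"

lemma length_phase_walk: "h \<in> set_pmf (phase_walk p \<alpha> n) \<Longrightarrow> length h = Suc n"
  by (induction n arbitrary: h) auto

lemma pmf_phase_walk_Suc:
  "pmf (phase_walk p \<alpha> (Suc n)) (z # h) = pmf (phase_walk p \<alpha> n) h * pmf (phase_law p \<alpha> (phase_of h)) (z - hd h)"
proof -
  have "pmf (map_pmf (\<lambda>s. (hd h' + s) # h') (phase_law p \<alpha> (phase_of h'))) (z # h)
     = indicator {h} h' * pmf (phase_law p \<alpha> (phase_of h)) (z - hd h)" for h'
  proof -
    have "(\<lambda>s. (hd h' + s) # h') -` {z # h} = (if h' = h then {z - hd h} else {})"
      by (auto simp: algebra_simps)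
    then show ?thesis by (simp add: pmf_map measure_pmf_single)
  qed
  then show ?thesis by (simp add: pmf_bind measure_pmf_single)
qed

text \<open>If the site being left is unknown, \<open>phase_law\<close> tosses a fresh coin, whose
  factor p or 1 - p is the one gained by \<open>env_prob\<close>. If it is known, the phase is
  \<open>Before_Block\<close> or \<open>On_Block\<close> and fixes the kind, and
  \<open>env_prob\<close> stays the same.\<close>

lemma pmf_phase_walk:
  assumes "p \<in> {0<..<1}" "length h = Suc n"
  shows "pmf (phase_walk p \<alpha> n) h = coin_weight \<alpha> h * env_prob p (known h)"
  using assms(2)
proof (induction n arbitrary: h)
  case 0
  then obtain z where "h = [z]" by (cases h) auto
  then show ?case by (simp add: env_prob_def)
next
  case (Suc n)
  then obtain z z' t where h: "h = z # z' # t" and len: "length (z' # t) = Suc n"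
    by (metis length_Suc_conv)
  define b where "b \<longleftrightarrow> z - z' \<noteq> - e1"
  let ?K = "known (z' # t)" let ?s = "phase_of (z' # t)" let ?w = "coin_weight \<alpha> (z' # t)"
  have K: "known h = ?K(z' \<mapsto> b)" unfolding h by (simp only: known.simps b_def)
  have cw: "coin_weight \<alpha> h = (if ?K z' = Some (\<not> b) then 0 else pmf (kind_law \<alpha> b) (z - z') * ?w)"
    unfolding h by (simp only: coin_weight.simps b_def not_not)
  have other: "pmf (kind_law \<alpha> (\<not> b)) (z - z') = 0"
    using kind_law_support[of \<alpha> "\<not> b" "z - z'"] by (cases b) (auto simp: b_def)
  have fresh: "pmf (bind_pmf (bernoulli_pmf p) (kind_law \<alpha>)) (z - z')
      = (if b then p else 1 - p) * pmf (kind_law \<alpha> b) (z - z')"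
    using other assms(1) by (cases b) (auto simp: pmf_bind)
  have "env_prob p ?K * (?w * pmf (phase_law p \<alpha> ?s) (z - z')) = coin_weight \<alpha> h * env_prob p (known h)"
  \<comment> \<open>The invariant is available only for histories of nonzero weight; for the others
    both sides are 0.\<close>
  proof (cases "?w = 0")
    case False
    from explored_history[OF this] have ex: "explored ?s z' ?K" by simp
    show ?thesis
    proof (cases "?K z'")
      case None
      then have "phase_law p \<alpha> ?s = bind_pmf (bernoulli_pmf p) (kind_law \<alpha>)"
        using ex by (cases ?s) (auto simp: explored_def phase_law_def)
      then show ?thesis using None by (simp add: K cw fresh env_prob_update_new)
    next
      case (Some b')
      then have "phase_law p \<alpha> ?s = kind_law \<alpha> b'"
        using ex by (cases z'; cases ?s) (auto simp: explored_def phase_law_def)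
      then show ?thesis using Some other
        by (cases "b' = b") (auto simp: K cw env_prob_update_same)
    qed
  qed (auto simp: cw)
  then show ?case
    unfolding h by (simp only: pmf_phase_walk_Suc Suc.IH[OF len] list.sel mult_ac)
qed

lemma measurable_annealed_history:
  "(\<lambda>X. history X n) \<in> measurable (annealed_law (iid_env_law \<mu>)) (count_space UNIV)"
  by (subst measurable_cong_sets[OF sets_annealed_law refl]) (rule measurable_history)

text \<open>Histories form a countable set, so equal point masses suffice. This carries bounds for
  the phase walk at each fixed time over to the annealed law, which is all that Borel-Cantelli
  requires.\<close>

lemma distr_annealed_history:
  assumes "p \<in> {0<..<1}"
  shows "distr (annealed_law (iid_env_law (site_law p \<alpha>))) (count_space UNIV) (\<lambda>X. history X n)
    = measure_pmf (phase_walk p \<alpha> n)"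
proof (rule measure_eqI_countable[where A=UNIV])
  fix h :: "site list"
  let ?P = "annealed_law (iid_env_law (site_law p \<alpha>))"
  note [measurable] = measurable_annealed_history
  have sp: "space ?P = UNIV"
    using sets_eq_imp_space_eq[OF sets_annealed_law] by (simp add: space_PiM)
  have "emeasure (distr ?P (count_space UNIV) (\<lambda>X. history X n)) {h} = emeasure ?P {X. history X n = h}"
    by (subst emeasure_distr) (auto simp: sp vimage_def)
  also have "\<dots> = ennreal (pmf (phase_walk p \<alpha> n) h)"
  proof (cases "length h = Suc n")
    case True
    then show ?thesis using assms by (simp add: emeasure_annealed_history pmf_phase_walk)
  next
    case False
    then have "{X. history X n = h} = {}" "pmf (phase_walk p \<alpha> n) h = 0"
      using length_phase_walk by (auto simp: pmf_eq_0_set_pmf)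
    then show ?thesis by simp
  qed
  finally show "emeasure (distr ?P (count_space UNIV) (\<lambda>X. history X n)) {h} =
      emeasure (measure_pmf (phase_walk p \<alpha> n)) {h}" by (simp add: emeasure_pmf_single)
qed auto

lemma set_phase_law: "set_pmf (phase_law p \<alpha> s) \<subseteq> {e1, e2, - e1}"
proof -
  have kind: "set_pmf (kind_law \<alpha> b) \<subseteq> {e1, e2, - e1}" for b
  proof
    fix e assume "e \<in> set_pmf (kind_law \<alpha> b)"
    then show "e \<in> {e1, e2, - e1}"
      using kind_law_support[of \<alpha> b e] by (cases b) (auto simp: set_pmf_iff)
  qed
  have "set_pmf (phase_law p \<alpha> s) \<subseteq> (\<Union>b. set_pmf (kind_law \<alpha> b))"
    by (cases s) (auto simp: phase_law_def)
  with kind show ?thesis by blast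
qed

lemma expectation_phase_law:
  fixes g :: "site \<Rightarrow> real"
  assumes "p \<in> {0<..<1}" "\<alpha> \<in> {0<..<1}"
  shows "measure_pmf.expectation (phase_law p \<alpha> s) g =
    (case s of Before_Block \<Rightarrow> \<alpha> * g e1 + (1 - \<alpha>) * g e2 | On_Block \<Rightarrow> g (- e1)
     | _ \<Rightarrow> p * (\<alpha> * g e1 + (1 - \<alpha>) * g e2) + (1 - p) * g (- e1))"
proof -
  have vim: "(\<lambda>b. if b then e1 else e2) -` {e1} = {True}" "(\<lambda>b. if b then e1 else e2) -` {e2} = {False}"
    "(\<lambda>b. if b then e1 else e2) -` {- e1} = {}" by (auto split: if_splits)
  have g1: "pmf (gamma1 \<alpha>) e1 = \<alpha>" "pmf (gamma1 \<alpha>) e2 = 1 - \<alpha>" "pmf (gamma1 \<alpha>) (- e1) = 0"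
    unfolding gamma1_def pmf_map vim using assms by (simp_all add: measure_pmf_single)
  have g2: "pmf gamma2 e1 = 0" "pmf gamma2 e2 = 0" "pmf gamma2 (- e1) = 1"
    by (simp_all add: gamma2_def)
  have fresh: "pmf (bind_pmf (bernoulli_pmf p) (kind_law \<alpha>)) e
      = p * pmf (gamma1 \<alpha>) e + (1 - p) * pmf gamma2 e" for e
    using assms(1) by (simp add: pmf_bind kind_law_def)
  have "measure_pmf.expectation (phase_law p \<alpha> s) g = (\<Sum>e\<in>{e1, e2, - e1}. g e * pmf (phase_law p \<alpha> s) e)"
    using set_phase_law by (intro integral_measure_pmf_real) auto
  also have "\<dots> = g e1 * pmf (phase_law p \<alpha> s) e1 + (g e2 * pmf (phase_law p \<alpha> s) e2
      + g (- e1) * pmf (phase_law p \<alpha> s) (- e1))"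
    by simp
  also have "\<dots> = (case s of Before_Block \<Rightarrow> \<alpha> * g e1 + (1 - \<alpha>) * g e2 | On_Block \<Rightarrow> g (- e1)
     | _ \<Rightarrow> p * (\<alpha> * g e1 + (1 - \<alpha>) * g e2) + (1 - p) * g (- e1))"
    unfolding phase_law_def
    by (cases s) (simp_all only: phase.case fresh kind_law_def if_True if_False g1 g2, simp_all add: algebra_simps)
  finally show ?thesis .
qed

section \<open>Law of large numbers from the Poisson equation\<close>

lemma phase_bounded: "\<exists>C. \<forall>s. \<bar>f s :: real\<bar> \<le> C" for f :: "phase \<Rightarrow> real"
proof (intro exI allI)
  fix s
  show "\<bar>f s\<bar> \<le> \<bar>f Arrived\<bar> + \<bar>f Eastward\<bar> + \<bar>f Westward\<bar> + \<bar>f Before_Block\<bar> + \<bar>f On_Block\<bar>"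
    by (cases s) auto
qed

definition poisson_solution ::
  "real \<Rightarrow> real \<Rightarrow> (site \<Rightarrow> real) \<Rightarrow> real \<Rightarrow> (phase \<Rightarrow> real) \<Rightarrow> bool" where
  "poisson_solution p \<alpha> g v f \<longleftrightarrow>
     (\<forall>s. measure_pmf.expectation (phase_law p \<alpha> s) (\<lambda>e. g e + f (next_phase s e)) = v + f s)"

text \<open>By the Poisson equation each martingale increment has conditional mean zero, and it lies
  in [-B, B]. Hoeffding's lemma bounds its conditional exponential moment, and conditioning on the
  history multiplies these bounds. The walk starts in \<open>Arrived\<close>.\<close>

lemma phase_walk_mgf:
  fixes g :: "site \<Rightarrow> real"
  assumes g: "\<And>x y. g (x + y) = g x + g y"
    and sol: "poisson_solution p \<alpha> g v f"
    and B: "\<And>s e. e \<in> {e1, e2, - e1} \<Longrightarrow> \<bar>g e + f (next_phase s e) - f s - v\<bar> \<le> B"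
    and l: "l > 0"
  shows "(\<integral>\<^sup>+h. exp (l * (g (hd h) - v * real n + f (phase_of h))) \<partial>phase_walk p \<alpha> n)
    \<le> ennreal (exp (l * f Arrived) * exp (l\<^sup>2 * B\<^sup>2 / 2) ^ n)"
proof (induction n)
  case 0
  have "g 0 = 0" using g[of 0 0] by simp
  then show ?case by simp
next
  case (Suc n)
  let ?Y = "\<lambda>s e. g e + f (next_phase s e) - f s - v"
  let ?M = "\<lambda>n h. exp (l * (g (hd h) - v * real n + f (phase_of h)))"
  let ?c = "exp (l\<^sup>2 * B\<^sup>2 / 2)"
  have Y: "(\<integral>\<^sup>+e. exp (l * ?Y s e) \<partial>phase_law p \<alpha> s) \<le> ennreal ?c" for s
  proof -
    have AE: "AE e in phase_law p \<alpha> s. ?Y s e \<in> {- B..B}"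
      unfolding AE_measure_pmf_iff
    proof
      fix e assume "e \<in> set_pmf (phase_law p \<alpha> s)"
      then have "e \<in> {e1, e2, - e1}" using set_phase_law by blast
      from B[OF this, of s] show "?Y s e \<in> {- B..B}" by (simp add: abs_le_iff)
    qed
    interpret interval_bounded_random_variable "measure_pmf (phase_law p \<alpha> s)" "?Y s" "- B" B
      by unfold_locales (use AE in auto)
    have int: "integrable (phase_law p \<alpha> s) u" for u :: "site \<Rightarrow> real"
      using finite_subset[OF set_phase_law] by (intro integrable_measure_pmf_finite) auto
    have "measure_pmf.expectation (phase_law p \<alpha> s) (\<lambda>e. g e + f (next_phase s e) - (f s + v)) = 0"
      using sol by (subst Bochner_Integration.integral_diff) (auto simp: int poisson_solution_def)
    then have "measure_pmf.expectation (phase_law p \<alpha> s) (?Y s) = 0"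
      by (simp add: diff_diff_eq)
    \<comment> \<open>The interval has length 2 B, so the exponent is l^2 (2 B)^2 / 8 = l^2 B^2 /
      2.\<close>
    from Hoeffdings_lemma_nn_integral_0[OF l this] show ?thesis
      by (simp add: power2_eq_square mult_ac)
  qed
  have "(\<integral>\<^sup>+h. ?M (Suc n) h \<partial>phase_walk p \<alpha> (Suc n)) =
     (\<integral>\<^sup>+h. \<integral>\<^sup>+e. ?M (Suc n) ((hd h + e) # h) \<partial>phase_law p \<alpha> (phase_of h) \<partial>phase_walk p \<alpha> n)"
    by simp
  also have "\<dots> = (\<integral>\<^sup>+h. \<integral>\<^sup>+e. ennreal (?M n h) * ennreal (exp (l * ?Y (phase_of h) e))
      \<partial>phase_law p \<alpha> (phase_of h) \<partial>phase_walk p \<alpha> n)"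
  proof (intro nn_integral_cong_AE, unfold AE_measure_pmf_iff, intro ballI nn_integral_cong)
    fix h e assume "h \<in> set_pmf (phase_walk p \<alpha> n)"
    then obtain z t where h: "h = z # t" using length_phase_walk by (metis length_Suc_conv)
    show "ennreal (?M (Suc n) ((hd h + e) # h)) = ennreal (?M n h) * ennreal (exp (l * ?Y (phase_of h) e))"
      unfolding ennreal_mult''[OF exp_ge_zero, symmetric] exp_add[symmetric]
      by (simp add: h g algebra_simps)
  qed
  also have "\<dots> = (\<integral>\<^sup>+h. ennreal (?M n h) * (\<integral>\<^sup>+e. exp (l * ?Y (phase_of h) e)
      \<partial>phase_law p \<alpha> (phase_of h)) \<partial>phase_walk p \<alpha> n)"
    by (simp add: nn_integral_cmult)
  also have "\<dots> \<le> (\<integral>\<^sup>+h. ennreal (?M n h) * ennreal ?c \<partial>phase_walk p \<alpha> n)"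
    by (intro nn_integral_mono mult_left_mono Y) simp
  also have "\<dots> = (\<integral>\<^sup>+h. ?M n h \<partial>phase_walk p \<alpha> n) * ennreal ?c"
    by (simp add: nn_integral_multc)
  also have "\<dots> \<le> ennreal (exp (l * f Arrived) * ?c ^ n) * ennreal ?c"
    by (intro mult_right_mono Suc) simp
  also have "\<dots> = ennreal (exp (l * f Arrived) * ?c ^ Suc n)"
    by (simp add: ennreal_mult''[symmetric] mult_ac)
  finally show ?case .
qed

text \<open>Markov's inequality for the exponential of the martingale; the bounded correction
  \<open>f\<close> costs only a constant factor.\<close>

lemma phase_walk_deviation:
  fixes g :: "site \<Rightarrow> real"
  assumes g: "\<And>x y. g (x + y) = g x + g y" and sol: "poisson_solution p \<alpha> g v f" and \<epsilon>: "\<epsilon> > 0"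
  shows "\<exists>K r. 0 \<le> r \<and> r < 1 \<and>
    (\<forall>n. measure (phase_walk p \<alpha> n) {h. g (hd h) - v * real n \<ge> \<epsilon> * real n} \<le> K * r ^ n)"
proof -
  obtain C where C: "\<And>s. \<bar>f s\<bar> \<le> C" using phase_bounded by blast
  \<comment> \<open>Bounds every martingale increment; the summand 1 keeps it positive for the
    divisions below.\<close>
  define B where "B = 1 + \<bar>g e1\<bar> + \<bar>g e2\<bar> + \<bar>g (- e1)\<bar> + 2 * C + \<bar>v\<bar>"
  have "C \<ge> 0" using C[of Arrived] by linarith
  then have "B > 0" by (simp add: B_def)
  have B: "\<bar>g e + f (next_phase s e) - f s - v\<bar> \<le> B" if "e \<in> {e1, e2, - e1}" for s e
  proof -
    have "\<bar>g e\<bar> \<le> \<bar>g e1\<bar> + \<bar>g e2\<bar> + \<bar>g (- e1)\<bar>" using that by auto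
    then show ?thesis using C[of s] C[of "next_phase s e"] unfolding B_def by linarith
  qed
  \<comment> \<open>This choice minimizes - l \<epsilon> + l^2 B^2 / 2, with minimum - \<epsilon>^2
    / (2 B^2).\<close>
  define l where "l = \<epsilon> / B\<^sup>2"
  have l: "l > 0" using \<epsilon> \<open>B > 0\<close> by (simp add: l_def)
  define r where "r = exp (- (\<epsilon>\<^sup>2 / (2 * B\<^sup>2)))"
  have r: "exp (- (l * \<epsilon>)) * exp (l\<^sup>2 * B\<^sup>2 / 2) = r"
    using \<open>B > 0\<close> unfolding r_def l_def exp_add[symmetric]
    by (simp add: field_simps power2_eq_square)
  \<comment> \<open>The summand \<open>C\<close> pays for bounding \<open>f\<close> from below at
    time \<open>n\<close>; \<open>f Arrived\<close> is its value at the start.\<close>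
  let ?K = "exp (l * (C + f Arrived))"
  have "measure (phase_walk p \<alpha> n) {h. g (hd h) - v * real n \<ge> \<epsilon> * real n} \<le> ?K * r ^ n" for n
  proof -
    let ?D = "{h. g (hd h) - v * real n \<ge> \<epsilon> * real n}"
    let ?M = "\<lambda>h. exp (l * (g (hd h) - v * real n + f (phase_of h)))"
    let ?a = "exp (l * (C - \<epsilon> * real n))"
    have "emeasure (phase_walk p \<alpha> n) ?D = (\<integral>\<^sup>+h. indicator ?D h \<partial>phase_walk p \<alpha> n)" by simp
    also have "\<dots> \<le> (\<integral>\<^sup>+h. ennreal ?a * ennreal (?M h) \<partial>phase_walk p \<alpha> n)"
    proof (intro nn_integral_mono)
      fix h
      have "1 \<le> ?a * ?M h" if "h \<in> ?D"
      proof -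
        have "0 \<le> C - \<epsilon> * real n + (g (hd h) - v * real n + f (phase_of h))"
        proof -
          have "\<epsilon> * real n \<le> g (hd h) - v * real n" using that by simp
          then show ?thesis using C[of "phase_of h"] by linarith
        qed
        then have "0 \<le> l * (C - \<epsilon> * real n + (g (hd h) - v * real n + f (phase_of h)))"
          using l by simp
        then show ?thesis unfolding exp_add[symmetric] distrib_left[symmetric] by simp
      qed
      then show "indicator ?D h \<le> ennreal ?a * ennreal (?M h)"
        by (auto simp: indicator_def ennreal_mult''[symmetric] simp flip: ennreal_1 simp del: mem_Collect_eq)
    qed
    also have "\<dots> = ennreal ?a * (\<integral>\<^sup>+h. ?M h \<partial>phase_walk p \<alpha> n)"
      by (simp add: nn_integral_cmult)
    also have "\<dots> \<le> ennreal ?a * ennreal (exp (l * f Arrived) * exp (l\<^sup>2 * B\<^sup>2 / 2) ^ n)"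
      by (intro mult_left_mono phase_walk_mgf g sol B l zero_le)
    also have "\<dots> = ennreal (?a * (exp (l * f Arrived) * exp (l\<^sup>2 * B\<^sup>2 / 2) ^ n))"
      by (simp add: ennreal_mult'')
    also have "?a * (exp (l * f Arrived) * exp (l\<^sup>2 * B\<^sup>2 / 2) ^ n) = ?K * r ^ n"
    proof -
      have a: "?a = exp (l * C) * exp (- (l * \<epsilon>)) ^ n"
        unfolding exp_of_nat_mult[symmetric] exp_add[symmetric] by (simp add: algebra_simps)
      have K: "?K = exp (l * C) * exp (l * f Arrived)"
        unfolding exp_add[symmetric] by (simp add: algebra_simps)
      show ?thesis unfolding a K r[symmetric] power_mult_distrib by (simp only: mult_ac)
    qed
    finally show ?thesis
      by (subst (asm) measure_pmf.emeasure_eq_measure) (simp add: r_def)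
  qed
  moreover have "0 \<le> r" "r < 1" using \<epsilon> \<open>B > 0\<close> by (simp_all add: r_def)
  ultimately show ?thesis by blast
qed

lemma annealed_eventually_less:
  fixes g :: "site \<Rightarrow> real"
  assumes p: "p \<in> {0<..<1}" and g: "\<And>x y. g (x + y) = g x + g y"
    and sol: "poisson_solution p \<alpha> g v f" and \<epsilon>: "\<epsilon> > 0"
  shows "AE X in annealed_law (iid_env_law (site_law p \<alpha>)).
    \<forall>\<^sub>F n in sequentially. g (X n) - v * real n < \<epsilon> * real n"
proof -
  let ?P = "annealed_law (iid_env_law (site_law p \<alpha>))"
  let ?D = "\<lambda>n. {h. g (hd h) - v * real n \<ge> \<epsilon> * real n}"
  let ?A = "\<lambda>n. (\<lambda>X. history X n) -` ?D n \<inter> space ?P"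
  interpret prob_space ?P by (rule prob_space_annealed_law)
  note hist [measurable] = measurable_annealed_history
  obtain K r where r: "0 \<le> r" "r < 1"
    and K: "\<And>n. measure (phase_walk p \<alpha> n) (?D n) \<le> K * r ^ n"
    using phase_walk_deviation[OF g sol \<epsilon>] by blast
  have sets: "?A n \<in> events" for n by (rule measurable_sets[OF hist]) simp
  have le: "prob (?A n) \<le> K * r ^ n" for n
    using K[of n] unfolding distr_annealed_history[OF p, symmetric] by (subst (asm) measure_distr) auto
  have "summable (\<lambda>n. K * r ^ n)" using r by (intro summable_mult summable_geometric) simp
  then have "summable (\<lambda>n. prob (?A n))"
    by (rule summable_comparison_test'[where N=0]) (simp only: real_norm_def abs_of_nonneg measure_nonneg le)
  then have "AE X in ?P. \<forall>\<^sub>F n in sequentially. X \<in> space ?P - ?A n"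
    by (intro borel_cantelli_AE1 sets) (simp_all only: emeasure_eq_measure ennreal_less_top infinity_ennreal_def)
  then show ?thesis
  proof eventually_elim
    case (elim X)
    then show ?case by eventually_elim auto
  qed
qed

lemma annealed_speed:
  fixes g :: "site \<Rightarrow> real"
  assumes p: "p \<in> {0<..<1}" and g: "\<And>x y. g (x + y) = g x + g y"
    and sol: "poisson_solution p \<alpha> g v f"
  shows "AE X in annealed_law (iid_env_law (site_law p \<alpha>)). (\<lambda>n. g (X n) / real n) \<longlonglongrightarrow> v"
proof -
  let ?P = "annealed_law (iid_env_law (site_law p \<alpha>))"
  \<comment> \<open>Negating \<open>g\<close>, \<open>v\<close> and \<open>f\<close> preserves the
    Poisson equation, so the one-sided bound also yields the lower one.\<close>
  have neg: "poisson_solution p \<alpha> (\<lambda>x. - g x) (- v) (\<lambda>s. - f s)"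
    unfolding poisson_solution_def
  proof
    fix s
    have "measure_pmf.expectation (phase_law p \<alpha> s) (\<lambda>e. - (g e + f (next_phase s e))) = - (v + f s)"
      using sol unfolding poisson_solution_def by (subst Bochner_Integration.integral_minus) auto
    then show "measure_pmf.expectation (phase_law p \<alpha> s) (\<lambda>e. - g e + - f (next_phase s e)) = - v + - f s"
      by simp
  qed
  \<comment> \<open>Countably many tolerances 1 / (k + 1) allow a single null set for all of
    them.\<close>
  have "AE X in ?P. \<forall>k. (\<forall>\<^sub>F n in sequentially. g (X n) - v * real n < 1 / real (Suc k) * real n) \<and>
      (\<forall>\<^sub>F n in sequentially. - g (X n) - (- v) * real n < 1 / real (Suc k) * real n)"
    unfolding AE_all_countable AE_conj_iff
    by (intro allI conjI annealed_eventually_less[OF p g sol] annealed_eventually_less[OF p _ neg])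
       (simp_all add: g)
  then show ?thesis
  proof eventually_elim
    case (elim X)
    show ?case
    proof (rule LIMSEQ_I)
      fix \<epsilon> :: real assume "\<epsilon> > 0"
      then obtain k where k: "1 / real (Suc k) < \<epsilon>"
        using nat_approx_posE by (metis of_nat_Suc)
      have "\<forall>\<^sub>F n in sequentially. g (X n) - v * real n < 1 / real (Suc k) * real n"
        "\<forall>\<^sub>F n in sequentially. - g (X n) - (- v) * real n < 1 / real (Suc k) * real n"
        using elim by blast+
      then have "\<forall>\<^sub>F n in sequentially. norm (g (X n) / real n - v) < \<epsilon>"
        using eventually_gt_at_top[of 0]
      proof eventually_elim
        case (elim n)
        then have "\<bar>g (X n) - v * real n\<bar> < 1 / real (Suc k) * real n" by linarith
        also have "\<dots> < \<epsilon> * real n" using k elim by (intro mult_strict_right_mono) auto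
        finally have "\<bar>g (X n) - v * real n\<bar> / real n < \<epsilon>" using elim by (simp add: divide_less_eq)
        moreover have "g (X n) / real n - v = (g (X n) - v * real n) / real n" using elim by (simp add: field_simps)
        ultimately show ?case by (simp add: abs_divide)
      qed
      then show "\<exists>N. \<forall>n\<ge>N. norm (g (X n) / real n - v) < \<epsilon>"
        by (simp add: eventually_sequentially)
    qed
  qed
qed

section \<open>Time and displacement in a row\<close>

text \<open>Renewal-reward argument: \<open>r\<close> and \<open>m\<close> are expected reward and
  time until the next move up, the value 0 at \<open>Arrived\<close> closing the row. The choice of
  \<open>v\<close> makes \<open>r - v * m\<close> vanish at \<open>Arrived\<close>, so closing a row
  and continuing into the next one amount to the same.\<close>

lemma poisson_solutionI:
  fixes g :: "site \<Rightarrow> real"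
  assumes reward: "\<And>s. measure_pmf.expectation (phase_law p \<alpha> s)
      (\<lambda>e. g e + (if next_phase s e = Arrived then 0 else r (next_phase s e))) = r s"
    and time: "\<And>s. measure_pmf.expectation (phase_law p \<alpha> s)
      (\<lambda>e. 1 + (if next_phase s e = Arrived then 0 else m (next_phase s e))) = m s"
    and v: "v * m Arrived = r Arrived"
  shows "poisson_solution p \<alpha> g v (\<lambda>s. r s - v * m s)"
  unfolding poisson_solution_def
proof
  fix s
  let ?R = "\<lambda>e. g e + (if next_phase s e = Arrived then 0 else r (next_phase s e))"
  let ?T = "\<lambda>e. 1 + (if next_phase s e = Arrived then 0 else m (next_phase s e))"
  have int: "integrable (phase_law p \<alpha> s) u" for u :: "site \<Rightarrow> real"
    using finite_subset[OF set_phase_law] by (intro integrable_measure_pmf_finite) auto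
  have "(\<lambda>e. g e + (r (next_phase s e) - v * m (next_phase s e))) = (\<lambda>e. v + (?R e - v * ?T e))"
    using v by (auto simp: algebra_simps)
  then have "measure_pmf.expectation (phase_law p \<alpha> s) (\<lambda>e. g e + (r (next_phase s e) - v * m (next_phase s e)))
      = measure_pmf.expectation (phase_law p \<alpha> s) (\<lambda>e. v + (?R e - v * ?T e))" by simp
  also have "\<dots> = v + (measure_pmf.expectation (phase_law p \<alpha> s) ?R - v * measure_pmf.expectation (phase_law p \<alpha> s) ?T)"
    by (simp only: Bochner_Integration.integral_add Bochner_Integration.integral_diff integral_mult_right_zero int
        lebesgue_integral_const measure_pmf.prob_space scaleR_one)
  also have "\<dots> = v + (r s - v * m s)" by (simp only: reward time)
  finally show "measure_pmf.expectation (phase_law p \<alpha> s) (\<lambda>e. g e + (r (next_phase s e) - v * m (next_phase s e)))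
      = v + (r s - v * m s)" .
qed

text \<open>Expected time and horizontal displacement until the walk next moves up.\<close>

definition row_time :: "real \<Rightarrow> real \<Rightarrow> phase \<Rightarrow> real" where
  "row_time p \<alpha> s = (let t = (1 + \<alpha>) / (1 - \<alpha>) in case s of
      Arrived \<Rightarrow> 1 / p - 1 + t - p * (p * \<alpha> / (1 - p * \<alpha>))
    | Eastward \<Rightarrow> (1 + (1 - p) * t) / (1 - p * \<alpha>)
    | Westward \<Rightarrow> 1 / p + 2 * \<alpha> / (1 - \<alpha>)
    | Before_Block \<Rightarrow> t
    | On_Block \<Rightarrow> 1 + t)"

definition row_displacement :: "real \<Rightarrow> real \<Rightarrow> phase \<Rightarrow> real" where
  "row_displacement p \<alpha> s = (case s of
      Arrived \<Rightarrow> p * (p * \<alpha> / (1 - p * \<alpha>)) - (1 - p) / p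
    | Eastward \<Rightarrow> (p * \<alpha> - (1 - p)) / (1 - p * \<alpha>)
    | Westward \<Rightarrow> - ((1 - p) / p)
    | Before_Block \<Rightarrow> 0
    | On_Block \<Rightarrow> - 1)"

lemma one_minus_mult_pos:
  assumes "p \<in> {0<..<1}" "\<alpha> \<in> {0<..<1}"
  shows "1 - p * \<alpha> > (0 :: real)"
proof -
  have "p * \<alpha> < 1 * 1" using assms by (intro mult_strict_mono) auto
  then show ?thesis by simp
qed

text \<open>First-step analysis. In \<open>Before_Block\<close> the walk either moves up or spends
  two steps on visiting the block, whence t = (1 - \<alpha>) + \<alpha> (2 + t);
  \<open>Westward\<close> first crosses (1 - p) / p blocks on average.\<close>

lemma row_time_step:
  assumes "p \<in> {0<..<1}" "\<alpha> \<in> {0<..<1}"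
  shows "measure_pmf.expectation (phase_law p \<alpha> s)
      (\<lambda>e. 1 + (if next_phase s e = Arrived then 0 else row_time p \<alpha> (next_phase s e))) = row_time p \<alpha> s"
proof -
  have ne: "p \<noteq> 0" "1 - \<alpha> \<noteq> 0" "1 - p * \<alpha> \<noteq> 0"
    using assms one_minus_mult_pos[OF assms] by auto
  \<comment> \<open>Naming the quotients turns every equation into a polynomial identity modulo the
    relations \<open>t\<close>, \<open>w\<close> and \<open>q\<close>.\<close>
  define t where "t = (1 + \<alpha>) / (1 - \<alpha>)"
  define w where "w = 1 / (1 - p * \<alpha>)"
  define q where "q = 1 / p"
  have t: "(1 - \<alpha>) * t = 1 + \<alpha>" and w: "(1 - p * \<alpha>) * w = 1" and q: "p * q = 1"
    using ne by (simp_all add: t_def w_def q_def)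
  have west: "2 * \<alpha> / (1 - \<alpha>) = t - 1" using ne by (simp add: t_def field_simps)
  have rt: "row_time p \<alpha> s = (case s of Arrived \<Rightarrow> q - 1 + t - p * (p * \<alpha> * w)
      | Eastward \<Rightarrow> (1 + (1 - p) * t) * w | Westward \<Rightarrow> q + (t - 1) | Before_Block \<Rightarrow> t | On_Block \<Rightarrow> 1 + t)" for s
    unfolding row_time_def Let_def t_def[symmetric] west by (cases s) (simp_all add: w_def q_def)
  show ?thesis
  proof (cases s)
    case Arrived
    show ?thesis unfolding expectation_phase_law[OF assms] rt Arrived
      by (simp add: next_phase_def) (use t w q in algebra)
  next
    case Eastward
    show ?thesis unfolding expectation_phase_law[OF assms] rt Eastward
      by (simp add: next_phase_def) (use t w q in algebra)
  next
    case Westward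
    show ?thesis unfolding expectation_phase_law[OF assms] rt Westward
      by (simp add: next_phase_def) (use t w q in algebra)
  next
    case Before_Block
    show ?thesis unfolding expectation_phase_law[OF assms] rt Before_Block
      by (simp add: next_phase_def) (use t w q in algebra)
  next
    case On_Block
    show ?thesis unfolding expectation_phase_law[OF assms] rt On_Block
      by (simp add: next_phase_def)
  qed
qed

text \<open>Shuttling between a \<open>gamma1\<close> site and its block has no net effect. From
  \<open>Arrived\<close>, the row ends at least k columns east (k > 0) with probability p (p
  \<alpha>)^k, and summing over k gives the positive term; the negative term is the mean number of
  blocks crossed westward.\<close>

lemma row_displacement_step:
  assumes "p \<in> {0<..<1}" "\<alpha> \<in> {0<..<1}"
  shows "measure_pmf.expectation (phase_law p \<alpha> s) (\<lambda>e. real_of_int (fst e) +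
      (if next_phase s e = Arrived then 0 else row_displacement p \<alpha> (next_phase s e))) = row_displacement p \<alpha> s"
proof -
  have ne: "p \<noteq> 0" "1 - p * \<alpha> \<noteq> 0"
    using assms one_minus_mult_pos[OF assms] by auto
  define w where "w = 1 / (1 - p * \<alpha>)"
  define q where "q = 1 / p"
  have w: "(1 - p * \<alpha>) * w = 1" and q: "p * q = 1"
    using ne by (simp_all add: w_def q_def)
  have rd: "row_displacement p \<alpha> s = (case s of Arrived \<Rightarrow> p * (p * \<alpha> * w) - (1 - p) * q
      | Eastward \<Rightarrow> (p * \<alpha> - (1 - p)) * w | Westward \<Rightarrow> - ((1 - p) * q) | Before_Block \<Rightarrow> 0 | On_Block \<Rightarrow> - 1)" for s
    unfolding row_displacement_def by (cases s) (simp_all add: w_def q_def)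
  show ?thesis
  proof (cases s)
    case Arrived
    show ?thesis unfolding expectation_phase_law[OF assms] rd Arrived
      by (simp add: next_phase_def) (use w q in algebra)
  next
    case Eastward
    show ?thesis unfolding expectation_phase_law[OF assms] rd Eastward
      by (simp add: next_phase_def) (use w q in algebra)
  next
    case Westward
    show ?thesis unfolding expectation_phase_law[OF assms] rd Westward
      by (simp add: next_phase_def) (use w q in algebra)
  next
    case Before_Block
    show ?thesis unfolding expectation_phase_law[OF assms] rd Before_Block
      by (simp add: next_phase_def)
  next
    case On_Block
    show ?thesis unfolding expectation_phase_law[OF assms] rd On_Block
      by (simp add: next_phase_def)
  qed
qed

text \<open>The move that closes a row is the only one that ascends, so the expected ascent is 1
  from every phase.\<close>

lemma row_ascent_step:
  assumes "p \<in> {0<..<1}" "\<alpha> \<in> {0<..<1}"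
  shows "measure_pmf.expectation (phase_law p \<alpha> s) (\<lambda>e. real_of_int (snd e) +
      (if next_phase s e = Arrived then 0 else 1)) = 1"
  unfolding expectation_phase_law[OF assms]
  by (cases s) (simp_all add: next_phase_def algebra_simps)

lemma row_time_Arrived:
  assumes "p \<in> {0<..<1}" "\<alpha> \<in> {0<..<1}"
  shows "v2 p \<alpha> = inverse (row_time p \<alpha> Arrived)"
    and "v1 p \<alpha> = row_displacement p \<alpha> Arrived / row_time p \<alpha> Arrived"
    and "row_time p \<alpha> Arrived > 0"
proof -
  have pos: "p > 0" "1 - p > 0" "\<alpha> > 0" "1 - \<alpha> > 0" "1 - p * \<alpha> > 0"
    using assms one_minus_mult_pos[OF assms] by auto
  let ?T = "row_time p \<alpha> Arrived" let ?D = "row_displacement p \<alpha> Arrived"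
  define u where "u = 1 / (1 - \<alpha>)"
  define w where "w = 1 / (1 - p * \<alpha>)"
  define q where "q = 1 / p"
  have rel: "(1 - \<alpha>) * u = 1" "(1 - p * \<alpha>) * w = 1" "p * q = 1"
    using pos by (simp_all add: u_def w_def q_def)
  have T: "?T = q - 1 + (1 + \<alpha>) * u - p * (p * \<alpha> * w)" and D: "?D = p * (p * \<alpha> * w) - (1 - p) * q"
    by (simp_all add: row_time_def row_displacement_def u_def w_def q_def)
  have "\<alpha> / (1 - \<alpha>) + p + (1 - p) / p + (1 - p) / ((1 - \<alpha>) * (1 - p * \<alpha>))
      = \<alpha> * u + p + (1 - p) * q + (1 - p) * (u * w)"
    by (simp add: u_def w_def q_def)
  also have "\<dots> = ?T" unfolding T using rel by algebra
  finally have T_eq: "\<alpha> / (1 - \<alpha>) + p + (1 - p) / p + (1 - p) / ((1 - \<alpha>) * (1 - p * \<alpha>)) = ?T" .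
  then show "v2 p \<alpha> = inverse ?T" by (simp only: v2_def)
  have "0 < \<alpha> / (1 - \<alpha>) + p + (1 - p) / p + (1 - p) / ((1 - \<alpha>) * (1 - p * \<alpha>))"
    using pos by (intro add_pos_pos divide_pos_pos mult_pos_pos) auto
  then show T0: "?T > 0" unfolding T_eq .
  have "\<alpha> + (1 - \<alpha>) * (p + 1 / p - 1) + (1 - p) / (1 - p * \<alpha>)
      = \<alpha> + (1 - \<alpha>) * (p + q - 1) + (1 - p) * w"
    by (simp add: w_def q_def)
  also have "\<dots> = ?T * (1 - \<alpha>)" unfolding T using rel by algebra
  finally have T1: "\<alpha> + (1 - \<alpha>) * (p + 1 / p - 1) + (1 - p) / (1 - p * \<alpha>) = ?T * (1 - \<alpha>)" .
  \<comment> \<open>Time plus displacement grows by 2 on a step east, by 1 on a step up and by 0 on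
    a step west. The number of steps east in a row is geometric with mean \<alpha> / (1 - \<alpha>),
    so the expected sum is (1 + \<alpha>) / (1 - \<alpha>).\<close>
  have "?D = (1 + \<alpha>) * u - ?T" unfolding T D using rel by algebra
  then have D_eq: "?D = (1 + \<alpha>) / (1 - \<alpha>) - ?T" by (simp add: u_def)
  have "v1 p \<alpha> = (1 + \<alpha>) * inverse (?T * (1 - \<alpha>)) - 1"
    by (simp only: v1_def T1)
  also have "\<dots> = ((1 + \<alpha>) / (1 - \<alpha>) - ?T) / ?T" using pos T0 by (simp add: field_simps)
  finally show "v1 p \<alpha> = row_displacement p \<alpha> Arrived / ?T" by (simp only: D_eq)
qed

lemma annealed_velocity:
  assumes "p \<in> {0<..<1}" "\<alpha> \<in> {0<..<1}"
  shows "AE X in annealed_law (iid_env_law (site_law p \<alpha>)).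
    (\<lambda>n. map_prod real_of_int real_of_int (X n) /\<^sub>R real n) \<longlonglongrightarrow> (v1 p \<alpha>, v2 p \<alpha>)"
proof -
  let ?P = "annealed_law (iid_env_law (site_law p \<alpha>))"
  note T = row_time_Arrived[OF assms]
  have "poisson_solution p \<alpha> (\<lambda>e. real_of_int (fst e)) (v1 p \<alpha>)
      (\<lambda>s. row_displacement p \<alpha> s - v1 p \<alpha> * row_time p \<alpha> s)"
    using T by (intro poisson_solutionI row_displacement_step row_time_step assms) simp
  then have 1: "AE X in ?P. (\<lambda>n. real_of_int (fst (X n)) / real n) \<longlonglongrightarrow> v1 p \<alpha>"
    by (rule annealed_speed[OF assms(1), rotated]) simp
  have "poisson_solution p \<alpha> (\<lambda>e. real_of_int (snd e)) (v2 p \<alpha>)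
      (\<lambda>s. 1 - v2 p \<alpha> * row_time p \<alpha> s)"
    using T by (intro poisson_solutionI row_ascent_step row_time_step assms) simp
  then have 2: "AE X in ?P. (\<lambda>n. real_of_int (snd (X n)) / real n) \<longlonglongrightarrow> v2 p \<alpha>"
    by (rule annealed_speed[OF assms(1), rotated]) simp
  from 1 2 show ?thesis
  proof eventually_elim
    case (elim X)
    have "map_prod real_of_int real_of_int (X n) /\<^sub>R real n
        = (real_of_int (fst (X n)) / real n, real_of_int (snd (X n)) / real n)" for n
      by (simp add: prod_eq_iff divide_inverse mult.commute)
    with tendsto_Pair[OF elim] show ?case by (simp only:)
  qed
qed

text \<open>Passing from almost sure convergence to probability one uses that the convergence event
  is measurable.\<close>

lemma prob_annealed_velocity:
  assumes "p \<in> {0<..<1}" "\<alpha> \<in> {0<..<1}"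
  shows "\<P>(X in annealed_law (iid_env_law (site_law p \<alpha>)).
    (\<lambda>n. map_prod real_of_int real_of_int (X n) /\<^sub>R real n) \<longlonglongrightarrow> (v1 p \<alpha>, v2 p \<alpha>)) = 1"
proof -
  let ?P = "annealed_law (iid_env_law (site_law p \<alpha>))"
  interpret prob_space ?P by (rule prob_space_annealed_law)
  have X: "(\<lambda>X. f (X n)) \<in> borel_measurable ?P" for f :: "site \<Rightarrow> real \<times> real" and n
    by (subst measurable_cong_sets[OF sets_annealed_law refl])
       (rule measurable_compose[OF measurable_component_singleton], auto)
  have "{X \<in> space ?P. (\<lambda>n. map_prod real_of_int real_of_int (X n) /\<^sub>R real n) \<longlonglongrightarrow> (v1 p \<alpha>, v2 p \<alpha>)} \<in> events"
    using X by (intro predE measurable_limit) 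
  then show ?thesis
    using annealed_velocity[OF assms] by (simp only: prob_Collect_eq_1)
qed

section \<open>Monotonicity in the parameters\<close>

lemma v2_strict_mono:
  assumes "\<alpha> \<in> {0<..<1}"
  shows "strict_mono_on {0<..<1} (\<lambda>p. v2 p \<alpha>)"
proof (rule strict_mono_onI)
  fix p q :: real assume p: "p \<in> {0<..<1}" and q: "q \<in> {0<..<1}" and "p < q"
  \<comment> \<open>Only 1 / p and this subtracted term of the row time depend on p, and both
    changes shorten the row.\<close>
  have "p * (p * \<alpha> / (1 - p * \<alpha>)) \<le> q * (q * \<alpha> / (1 - q * \<alpha>))"
    using p q \<open>p < q\<close> assms one_minus_mult_pos[OF q assms] one_minus_mult_pos[OF p assms]
    by (intro mult_mono frac_le) auto
  moreover have "1 / q < 1 / p" using p \<open>p < q\<close> by (simp add: frac_less2)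
  ultimately have "row_time q \<alpha> Arrived < row_time p \<alpha> Arrived"
    by (simp add: row_time_def)
  then show "v2 p \<alpha> < v2 q \<alpha>"
    unfolding row_time_Arrived(1)[OF p assms] row_time_Arrived(1)[OF q assms]
    using row_time_Arrived(3)[OF q assms] by (rule less_imp_inverse_less)
qed

text \<open>The row time increases in \<alpha>: between a and b its growing term gains 2 (b - a) /
  ((1 - a) (1 - b)), while the subtracted term gains only p^2 (b - a) / ((1 - p a) (1 - p b)), which
  is less as p < 1.\<close>

lemma v2_strict_antimono:
  assumes p: "p \<in> {0<..<1}"
  shows "strict_antimono_on {0<..<1} (\<lambda>\<alpha>. v2 p \<alpha>)"
proof (rule monotone_onI)
  fix a b :: real assume a: "a \<in> {0<..<1}" and b: "b \<in> {0<..<1}" and "a < b"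
  have pos: "p > 0" "1 - p > 0" "a > 0" "b > 0" "1 - a > 0" "1 - b > 0" "1 - p * a > 0" "1 - p * b > 0"
    using p a b one_minus_mult_pos[OF p a] one_minus_mult_pos[OF p b] by auto
  \<comment> \<open>Collects the dependence on \<alpha> in two fractions whose differences have
    simple closed forms.\<close>
  have split: "row_time p x Arrived = 1 / p - 1 + p + (1 + x) / (1 - x) - p * (1 / (1 - p * x))"
    if "1 - p * x > 0" for x
  proof -
    have frac: "p * x / (1 - p * x) = 1 / (1 - p * x) - 1" using that by (simp add: field_simps)
    show ?thesis
      by (simp only: row_time_def Let_def phase.case frac) (simp add: right_diff_distrib)
  qed
  have le: "(1 - a) * (1 - b) \<le> (1 - p * a) * (1 - p * b)"
    using pos p a b by (intro mult_mono) auto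
  have "p * (1 / (1 - p * b)) - p * (1 / (1 - p * a)) = p * p * (b - a) / ((1 - p * a) * (1 - p * b))"
    using pos by (simp add: field_simps)
  also have "\<dots> \<le> p * p * (b - a) / ((1 - a) * (1 - b))"
    using pos le \<open>a < b\<close> by (intro divide_left_mono) auto
  also have "\<dots> < 2 * (b - a) / ((1 - a) * (1 - b))"
  proof (intro divide_strict_right_mono mult_strict_right_mono)
    have "p * p < 1 * 1" using p by (intro mult_strict_mono) auto
    then show "p * p < 2" by simp
  qed (use pos \<open>a < b\<close> in auto)
  also have "\<dots> = (1 + b) / (1 - b) - (1 + a) / (1 - a)"
    using pos by (simp add: field_simps)
  finally have "row_time p a Arrived < row_time p b Arrived"
    using pos by (simp add: split)
  then show "v2 p b < v2 p a"
    unfolding row_time_Arrived(1)[OF p a] row_time_Arrived(1)[OF p b]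
    using row_time_Arrived(3)[OF p a] by (rule less_imp_inverse_less)
qed

text \<open>At p = 9/10 the speed is slightly negative for \<alpha> = 1/10, about 0.26 for \<alpha>
  = 1/2 and about 0.04 for \<alpha> = 99/100: as \<alpha> tends to 1 the walk wastes ever more time
  shuttling at blocks.\<close>

lemma v1_not_monotone:
  "\<not> mono_on {0<..<1} (\<lambda>\<alpha>. v1 (9/10) \<alpha>)" "\<not> antimono_on {0<..<1} (\<lambda>\<alpha>. v1 (9/10) \<alpha>)"
proof -
  have less: "v1 (9/10) (1/10) < v1 (9/10) (1/2)" "v1 (9/10) (99/100) < v1 (9/10) (1/2)"
    by (simp_all add: v1_def)
  show "\<not> mono_on {0<..<1} (\<lambda>\<alpha>. v1 (9/10) \<alpha>)"
  proof
    assume "mono_on {0<..<1} (\<lambda>\<alpha>. v1 (9/10) \<alpha>)"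
    from monotone_onD[OF this, of "1/2" "99/100"] less(2) show False by simp
  qed
  show "\<not> antimono_on {0<..<1} (\<lambda>\<alpha>. v1 (9/10) \<alpha>)"
  proof
    assume "antimono_on {0<..<1} (\<lambda>\<alpha>. v1 (9/10) \<alpha>)"
    from monotone_onD[OF this, of "1/10" "1/2"] less(1) show False by simp
  qed
qed

theorem mainTheorem10:
  shows
    "(\<forall>p\<in>{0<..<1}. \<forall>\<alpha>\<in>{0<..<1}.
        \<P>(X in annealed_law (iid_env_law (site_law p \<alpha>)).
          (\<lambda>n. map_prod real_of_int real_of_int (X n) /\<^sub>R real n) \<longlonglongrightarrow> (v1 p \<alpha>, v2 p \<alpha>)) = 1)
     \<and> (\<forall>\<alpha>\<in>{0<..<1}. strict_mono_on {0<..<1} (\<lambda>p. v2 p \<alpha>))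
     \<and> (\<forall>p\<in>{0<..<1}. strict_antimono_on {0<..<1} (\<lambda>\<alpha>. v2 p \<alpha>))
     \<and> (\<exists>p\<in>{0<..<1}. \<not> mono_on {0<..<1} (\<lambda>\<alpha>. v1 p \<alpha>) \<and> \<not> antimono_on {0<..<1} (\<lambda>\<alpha>. v1 p \<alpha>))"
proof (intro conjI ballI)
  show "\<exists>p\<in>{0<..<1}. \<not> mono_on {0<..<1} (\<lambda>\<alpha>. v1 p \<alpha>) \<and> \<not> antimono_on {0<..<1} (\<lambda>\<alpha>. v1 p \<alpha>)"
    using v1_not_monotone by (intro bexI[of _ "9/10"]) auto
qed (rule prob_annealed_velocity v2_strict_mono v2_strict_antimono; assumption)+

end
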